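(* Let $G$ be an algebra (possibly non-associative) over a field. If $G$ contains a subspace $N$ of finite codimension satisfying a multilinear identity $w(x_1,\dots,x_t)=0$, then $G$ contains a subspace $H$ which satisfies the same identity, is invariant under all surjective endomorphisms of $G$, and has $$\operatorname{codim}H\le f^{t-1}(\operatorname{codim}N),$$ where $f^k(x)$ is the $k$-th iteration of the function $f(x)=x(x+1)$. Moreover, this subspace $H$ is a left, right, or two-sided ideal if the subspace $N$ is a left, right, or two-sided ideal, respectively.
   Context: Here $w(x_1,\dots,x_t)$ is a multilinear element (in the usual sense: linear in each of $x_1,\dots,x_t$) of the free non-associative algebra over the ground field. A subspace $N$ of $G$ satisfies the identity $w(x_1,\dots,x_t)=0$ if $w(a_1,\dots,a_t)=0$ in $G$ for all $a_1,\dots,a_t\in N$. Codimensions are taken in $G$. *)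

theory Defs
  imports Complex_Main "HOL-Library.Poly_Mapping"
begin

section \<open>The free non-associative algebra\<close>

text \<open>
  The free (non-unital) non-associative algebra on the variables \<open>'x\<close> over \<open>'k\<close> has the
  elements of the free magma, i.e. the bracketed non-empty words, as a basis. Its elements are the
  finitely supported functions from such words to \<open>'k\<close>.
\<close>

datatype 'x magma_word = Var 'x | Prod "'x magma_word" "'x magma_word"

type_synonym ('x, 'k) free_algebra = "'x magma_word \<Rightarrow>\<^sub>0 'k"

primrec degree_in :: "'x \<Rightarrow> 'x magma_word \<Rightarrow> nat" where
  "degree_in i (Var j) = (if j = i then 1 else 0)"
| "degree_in i (Prod u v) = degree_in i u + degree_in i v"

text \<open>
  The variables \<open>x\<^sub>1, \<dots>, x\<^sub>t\<close> are represented by their indices. An element is linear in \<open>x\<^sub>i\<close> if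
  \<open>x\<^sub>i\<close> occurs exactly once in each of its words.
\<close>

definition multilinear :: "nat \<Rightarrow> (nat, 'k::zero) free_algebra \<Rightarrow> bool" where
  "multilinear t w \<longleftrightarrow>
     (\<forall>m \<in> Poly_Mapping.keys w. set_magma_word m \<subseteq> {1..t} \<and> (\<forall>i\<in>{1..t}. degree_in i m = 1))"


section \<open>Algebras over a field, identities and ideals\<close>

locale nonassoc_algebra = vector_space scale
  for scale :: "'k::field \<Rightarrow> 'g::ab_group_add \<Rightarrow> 'g" +
  fixes mult :: "'g \<Rightarrow> 'g \<Rightarrow> 'g"
  assumes linear_mult_right: "Vector_Spaces.linear scale scale (\<lambda>y. mult x y)"
    and linear_mult_left: "Vector_Spaces.linear scale scale (\<lambda>x. mult x y)"
begin

primrec eval_word :: "('x \<Rightarrow> 'g) \<Rightarrow> 'x magma_word \<Rightarrow> 'g" where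
  "eval_word a (Var i) = a i"
| "eval_word a (Prod u v) = mult (eval_word a u) (eval_word a v)"

definition eval :: "('x \<Rightarrow> 'g) \<Rightarrow> ('x, 'k) free_algebra \<Rightarrow> 'g" where
  "eval a w = (\<Sum>m \<in> Poly_Mapping.keys w. scale (Poly_Mapping.lookup w m) (eval_word a m))"

definition satisfies :: "nat \<Rightarrow> (nat, 'k) free_algebra \<Rightarrow> 'g set \<Rightarrow> bool" where
  "satisfies t w N \<longleftrightarrow> (\<forall>a. (\<forall>i\<in>{1..t}. a i \<in> N) \<longrightarrow> eval a w = 0)"

definition endomorphism :: "('g \<Rightarrow> 'g) \<Rightarrow> bool" where
  "endomorphism \<phi> \<longleftrightarrow>
     Vector_Spaces.linear scale scale \<phi> \<and> (\<forall>x y. \<phi> (mult x y) = mult (\<phi> x) (\<phi> y))"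

definition left_ideal :: "'g set \<Rightarrow> bool" where
  "left_ideal I \<longleftrightarrow> subspace I \<and> (\<forall>g. \<forall>x\<in>I. mult g x \<in> I)"

definition right_ideal :: "'g set \<Rightarrow> bool" where
  "right_ideal I \<longleftrightarrow> subspace I \<and> (\<forall>g. \<forall>x\<in>I. mult x g \<in> I)"

definition two_sided_ideal :: "'g set \<Rightarrow> bool" where
  "two_sided_ideal I \<longleftrightarrow> left_ideal I \<and> right_ideal I"

end


section \<open>Codimension of a subspace\<close>

context nonassoc_algebra
begin

text \<open>
  \<open>quotient_basis N B\<close>: the classes of the elements of \<open>B\<close> (which are then pairwise distinct)
  form a basis of the quotient space \<open>G/N\<close>, where \<open>G\<close> is the whole algebra. Linear independence and
  spanning in \<open>G/N\<close> are written out in terms of representatives.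
\<close>

definition quotient_basis :: "'g set \<Rightarrow> 'g set \<Rightarrow> bool" where
  "quotient_basis N B \<longleftrightarrow>
     (\<forall>S u. finite S \<and> S \<subseteq> B \<and> (\<Sum>v\<in>S. scale (u v) v) \<in> N \<longrightarrow> (\<forall>v\<in>S. u v = 0)) \<and>
     (\<forall>x. \<exists>y\<in>span B. x - y \<in> N)"

definition finite_codim :: "'g set \<Rightarrow> bool" where
  "finite_codim N \<longleftrightarrow> (\<exists>B. finite B \<and> quotient_basis N B)"

text \<open>
  As for \<^const>\<open>dim\<close>, the value is meaningful only in the finite case. It does not depend on the
  chosen basis: see \<open>codim_eq_card\<close> below.
\<close>

definition codim :: "'g set \<Rightarrow> nat" where
  "codim N = card (SOME B. quotient_basis N B)"

lemma quotient_basis_card_le: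
  assumes N: "subspace N" and B: "quotient_basis N B" "finite B" and C: "quotient_basis N C"
  shows "finite C \<and> card C \<le> card B"
proof -
  obtain y where y: "y x \<in> span B" "x - y x \<in> N" for x
    using B(1) unfolding quotient_basis_def by metis
  have key: "\<forall>v\<in>S. u v = 0"
    if S: "finite S" "S \<subseteq> C" and 0: "(\<Sum>v\<in>S. scale (u v) (y v)) = 0" for S u
  proof -
    have "(\<Sum>v\<in>S. scale (u v) (v - y v)) \<in> N"
      using N y(2) by (intro subspace_sum subspace_scale) auto
    then have "(\<Sum>v\<in>S. scale (u v) v) \<in> N"
      using 0 by (simp add: scale_right_diff_distrib sum_subtractf)
    then show ?thesis
      using C S unfolding quotient_basis_def by blast
  qed
  have inj: "inj_on y C"
  proof (rule inj_onI, rule ccontr)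
    fix a b assume ab: "a \<in> C" "b \<in> C" "y a = y b" "a \<noteq> b"
    have "\<forall>v\<in>{a, b}. (if v = a then 1 else - 1 :: 'k) = 0"
      by (rule key) (use ab in auto)
    then show False by simp
  qed
  have "independent (y ` C)"
    unfolding independent_explicit_module
  proof (intro allI impI)
    fix T u v
    assume T: "finite T" "T \<subseteq> y ` C" "(\<Sum>v\<in>T. scale (u v) v) = 0" "v \<in> T"
    obtain S where S: "S \<subseteq> C" "finite S" "T = y ` S"
      using finite_subset_image[OF T(1,2)] by blast
    have "inj_on y S" using inj S(1) by (rule inj_on_subset)
    then have "(\<Sum>v\<in>S. scale (u (y v)) (y v)) = 0"
      using T(3) S(3) by (simp add: sum.reindex)
    from key[OF S(2,1) this] show "u v = 0" using T(4) S(3) by auto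
  qed
  moreover have "y ` C \<subseteq> span B" using y(1) by auto
  ultimately have "finite (y ` C) \<and> card (y ` C) \<le> card B"
    using independent_span_bound[OF B(2)] by blast
  then show ?thesis using inj by (simp add: card_image finite_image_iff)
qed

lemma codim_eq_card:
  assumes "subspace N" "quotient_basis N B" "finite B"
  shows "codim N = card B"
proof -
  define C where "C = (SOME B. quotient_basis N B)"
  have C: "quotient_basis N C" unfolding C_def using assms(2) by (rule someI)
  with quotient_basis_card_le[OF assms this] quotient_basis_card_le[OF assms(1) C _ assms(2)]
  show ?thesis unfolding codim_def C_def[symmetric] by auto
qed

end

end

theory Submission
  imports Defs
begin

text \<open>
  Let \<open>G\<close> be the algebra, \<open>n = codim N\<close>, and let \<open>\<phi>\<close> range over the surjective endomorphisms of \<open>G\<close>.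
  Every \<open>\<phi> N\<close> satisfies the identity too, and \<open>codim (\<phi> N) \<le> n\<close>. Two subspaces compete: the sum
  \<open>H\<^sub>1\<close> of all \<open>\<phi> N\<close> is invariant but need not satisfy the identity, whereas an intersection of several
  \<open>\<phi> N\<close> satisfies the identity but need not be invariant. Finite codimension relates
  the two: each time a summand \<open>\<phi> N\<close> strictly enlarges a partial sum, the codimension drops, so at
  most \<open>n + 1\<close> of the \<open>\<phi> N\<close>, one of them \<open>N\<close> itself, already have the sum \<open>H\<^sub>1\<close>. The intersection
  \<open>M\<^sub>1\<close> of these few has codimension at most \<open>(n + 1) n = f n\<close>.

  If \<open>x\<^sub>2, \<dots>, x\<^sub>t\<close> lie in \<open>M\<^sub>1\<close>, then \<open>w\<close> vanishes for \<open>x\<^sub>1\<close> in each of the chosen \<open>\<phi> N\<close>, because then all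
  arguments lie in \<open>\<phi> N\<close>; by linearity in \<open>x\<^sub>1\<close> it vanishes for all \<open>x\<^sub>1\<close> in \<open>H\<^sub>1\<close>. So the first variable
  has been freed from \<open>N\<close> and moved to an invariant subspace, at the price of replacing \<open>N\<close> by \<open>M\<^sub>1\<close>
  for the others. The same step (\<open>symmetrize_next_variable\<close>) is repeated with \<open>M\<^sub>1\<close> in place of \<open>N\<close>
  and the next variable. Surjective endomorphisms map the invariant subspaces onto themselves, so that
  the vanishing \<open>w(H\<^sub>1, M\<^sub>1, \<dots>, M\<^sub>1) = 0\<close> may be transported by each \<open>\<phi>\<close> without changing \<open>H\<^sub>1\<close>.
  This yields decreasing invariant subspaces \<open>H\<^sub>1, \<dots>, H\<^sub>t\<close> with \<open>w(H\<^sub>1, \<dots>, H\<^sub>t) = 0\<close>, and \<open>H = H\<^sub>t\<close> is the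
  subspace sought. It contains the subspace \<open>M\<close> obtained after \<open>t - 1\<close> steps, whence the bound
  \<open>f\<^sup>t\<^sup>-\<^sup>1 n\<close>. Sums, intersections and images under surjective endomorphisms of ideals are ideals, so
  the ideal properties survive every step.
\<close>

section \<open>Codimension through spanning sets\<close>

context nonassoc_algebra
begin

definition spans_mod :: "'g set \<Rightarrow> 'g set \<Rightarrow> bool" where
  "spans_mod M B \<longleftrightarrow> (\<forall>x. \<exists>y\<in>span B. x - y \<in> M)"

text \<open>
  For upper bounds it is easier to exhibit elements that span the quotient than to exhibit a basis of
  it: spanning sets behave well under enlarging the subspace, surjective maps and intersections.
  The lemma \<open>codim_at_most_iff\<close> is the link to \<^const>\<open>codim\<close>.
\<close>

definition codim_at_most :: "'g set \<Rightarrow> nat \<Rightarrow> bool" where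
  "codim_at_most M n \<longleftrightarrow> (\<exists>B. finite B \<and> card B \<le> n \<and> spans_mod M B)"

text \<open>
  A nontrivial relation modulo \<open>M\<close> expresses each element with a nonzero coefficient through the others. This one
  exchange argument serves twice: a smallest spanning set satisfies no such relation and hence is a
  basis of the quotient, and enlarging \<open>M\<close> strictly creates such a relation.
\<close>

lemma spans_mod_remove:
  assumes M: "subspace M" and B: "spans_mod M B" "finite B"
    and rel: "(\<Sum>b\<in>B. scale (u b) b) \<in> M" and v: "v \<in> B" "u v \<noteq> 0"
  shows "spans_mod M (B - {v})"
  unfolding spans_mod_def
proof
  fix x
  define r where "r = (\<Sum>b\<in>B - {v}. scale (u b) b)"
  have r: "r \<in> span (B - {v})"
    unfolding r_def by (intro span_sum span_scale span_base)
  have "scale (u v) v + r \<in> M"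
    using rel v B(2) unfolding r_def by (simp add: sum.remove)
  then have "scale (inverse (u v)) (scale (u v) v + r) \<in> M"
    using M by (rule subspace_scale[rotated])
  then have vr: "v + scale (inverse (u v)) r \<in> M"
    using v(2) by (simp add: scale_right_distrib)
  obtain y where y: "y \<in> span B" "x - y \<in> M"
    using B(1) unfolding spans_mod_def by blast
  have "y \<in> span (insert v (B - {v}))"
    using y(1) v(1) by (simp add: insert_absorb)
  then obtain k where k: "y - scale k v \<in> span (B - {v})"
    unfolding span_breakdown_eq by blast
  define z where "z = (y - scale k v) - scale k (scale (inverse (u v)) r)"
  have "z \<in> span (B - {v})"
    unfolding z_def by (intro span_diff span_scale k r)
  moreover have eq: "x - z = (x - y) + scale k (v + scale (inverse (u v)) r)"
    unfolding z_def by (simp add: scale_right_distrib algebra_simps)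
  have "x - z \<in> M"
    unfolding eq by (rule subspace_add[OF M y(2) subspace_scale[OF M vr]])
  ultimately show "\<exists>z\<in>span (B - {v}). x - z \<in> M" by blast
qed

lemma codim_at_most_iff:
  assumes M: "subspace M"
  shows "codim_at_most M n \<longleftrightarrow> finite_codim M \<and> codim M \<le> n"
proof
  assume "codim_at_most M n"
  then obtain B0 where B0: "finite B0 \<and> spans_mod M B0" "card B0 \<le> n"
    unfolding codim_at_most_def by blast
  obtain B where B: "finite B" "spans_mod M B"
    and least: "\<And>C. finite C \<and> spans_mod M C \<Longrightarrow> card B \<le> card C"
    using ex_has_least_nat[where P = "\<lambda>B. finite B \<and> spans_mod M B" and m = card, OF B0(1)]
    by blast
  have indep: "u v = 0" if S: "finite S" "S \<subseteq> B" "(\<Sum>v\<in>S. scale (u v) v) \<in> M" "v \<in> S" for S u v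
  proof (rule ccontr)
    assume "u v \<noteq> 0"
    \<comment> \<open>Extending the relation by zero coefficients makes it a relation between all elements of \<open>B\<close>.\<close>
    let ?u = "\<lambda>b. if b \<in> S then u b else 0"
    have "(\<Sum>b\<in>B. scale (?u b) b) = (\<Sum>b\<in>S. scale (u b) b)"
      using S(2) B(1) by (intro sum.mono_neutral_cong_right) auto
    with S(3) have "(\<Sum>b\<in>B. scale (?u b) b) \<in> M" by simp
    then have "spans_mod M (B - {v})"
      by (rule spans_mod_remove[OF M B(2,1)]) (use S \<open>u v \<noteq> 0\<close> in auto)
    then have "card B \<le> card (B - {v})"
      using B(1) by (intro least) simp
    moreover have "v \<in> B" using S by blast
    ultimately show False
      using B(1) by (metis card_Diff1_less leD)
  qed
  have qb: "quotient_basis M B"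
    unfolding quotient_basis_def
  proof (intro conjI allI impI ballI)
    fix S u v assume "finite S \<and> S \<subseteq> B \<and> (\<Sum>v\<in>S. scale (u v) v) \<in> M" "v \<in> S"
    then show "u v = 0" by (intro indep[of S u v]) auto
  next
    fix x show "\<exists>y\<in>span B. x - y \<in> M" using B(2) unfolding spans_mod_def by (rule spec)
  qed
  then have "codim M = card B" by (rule codim_eq_card[OF M _ B(1)])
  then have "codim M \<le> n" using least[OF B0(1)] B0(2) by simp
  then show "finite_codim M \<and> codim M \<le> n"
    using B(1) qb unfolding finite_codim_def by blast
next
  assume "finite_codim M \<and> codim M \<le> n"
  then obtain B where B: "finite B" "quotient_basis M B" "codim M \<le> n"
    unfolding finite_codim_def by blast
  then have "card B \<le> n" by (simp add: codim_eq_card[OF M])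
  moreover have "spans_mod M B"
    using B(2) unfolding quotient_basis_def spans_mod_def by (rule conjunct2)
  ultimately show "codim_at_most M n"
    using B(1) unfolding codim_at_most_def by blast
qed

lemma codim_at_most_mono: "codim_at_most M n \<Longrightarrow> M \<subseteq> M' \<Longrightarrow> codim_at_most M' n"
  unfolding codim_at_most_def spans_mod_def by (elim ex_forward conjE) (meson subsetD)

lemma codim_at_most_le: "codim_at_most M m \<Longrightarrow> m \<le> n \<Longrightarrow> codim_at_most M n"
  unfolding codim_at_most_def by (elim ex_forward) auto

text \<open>
  This strict drop has two uses: it bounds the number of images whose sum is the sum of all of them, and
  it forces surjective endomorphisms to map an invariant subspace of finite codimension onto itself.
\<close>

lemma codim_at_most_strict:
  assumes sub: "subspace M" "subspace M'" "M \<subset> M'" and cod: "codim_at_most M n"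
  shows "0 < n \<and> codim_at_most M' (n - 1)"
proof -
  obtain B where B: "finite B" "card B \<le> n" "spans_mod M B"
    using cod unfolding codim_at_most_def by blast
  obtain m where m: "m \<in> M'" "m \<notin> M" using sub(3) by blast
  obtain y where y: "y \<in> span B" "m - y \<in> M"
    using B(3) unfolding spans_mod_def by blast
  obtain u where u: "y = (\<Sum>b\<in>B. scale (u b) b)"
    using y(1) unfolding span_finite[OF B(1)] by auto
  have "m - (m - y) \<in> M'"
    by (rule subspace_diff[OF sub(2) m(1)]) (use y(2) sub(3) in blast)
  then have yM': "(\<Sum>b\<in>B. scale (u b) b) \<in> M'" using u by simp
  have "\<exists>v\<in>B. u v \<noteq> 0"
  proof (rule ccontr)
    assume "\<not> ?thesis"
    then have "y = 0" using u by simp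
    then show False using y(2) m(2) by simp
  qed
  then obtain v where v: "v \<in> B" "u v \<noteq> 0" by blast
  have "spans_mod M' B"
    using B(3) sub(3) unfolding spans_mod_def by blast
  then have "spans_mod M' (B - {v})"
    using spans_mod_remove[OF sub(2) _ B(1) yM'] v by blast
  moreover have "card (B - {v}) \<le> n - 1" "0 < n"
    using B(1,2) v(1) card_gt_0_iff[of B] by auto
  ultimately show ?thesis
    using B(1) unfolding codim_at_most_def by blast
qed

lemma codim_at_most_surj_image:
  assumes lin: "Vector_Spaces.linear scale scale \<phi>" and surj: "surj \<phi>"
    and cod: "codim_at_most M n"
  shows "codim_at_most (\<phi> ` M) n"
proof -
  interpret \<phi>: Vector_Spaces.linear scale scale \<phi> by (rule lin)
  obtain B where B: "finite B" "card B \<le> n" "spans_mod M B"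
    using cod unfolding codim_at_most_def by blast
  have "\<exists>y\<in>span (\<phi> ` B). x - y \<in> \<phi> ` M" for x
  proof -
    obtain x' where x': "x = \<phi> x'" using surj by blast
    obtain y where "y \<in> span B" "x' - y \<in> M"
      using B(3) unfolding spans_mod_def by blast
    then have "\<phi> y \<in> span (\<phi> ` B)" "x - \<phi> y \<in> \<phi> ` M"
      by (auto simp: \<phi>.span_image x' simp flip: \<phi>.diff)
    then show ?thesis by blast
  qed
  moreover have "card (\<phi> ` B) \<le> n"
    using card_image_le[OF B(1)] B(2) by (rule le_trans)
  ultimately show ?thesis
    using B(1) unfolding codim_at_most_def spans_mod_def by blast
qed

text \<open>
  By induction on the spanning set \<open>C\<close> of the quotient by \<open>B\<close>: adjoining one element \<open>c\<close> of \<open>C\<close> to \<open>B\<close>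
  gives a subspace \<open>B'\<close> whose quotient needs one element fewer. Inside \<open>A\<close>, the passage from \<open>B'\<close> back to
  \<open>B\<close> is either no change at all or costs one further spanning element.
\<close>

lemma codim_at_most_Int_spans_mod:
  assumes "finite C" and "subspace A" and "codim_at_most A m"
    and "subspace B" and "spans_mod B C"
  shows "codim_at_most (A \<inter> B) (m + card C)"
  using assms(1,4,5)
proof (induction C arbitrary: B rule: finite_induct)
  case empty
  then have "x \<in> B" for x by (simp add: spans_mod_def)
  then have "A \<inter> B = A" by blast
  then show ?case using assms(3) by simp
next
  case (insert c C)
  define B' where "B' = span (insert c B)"
  have spB: "span B = B"
    using insert.prems(1) by (simp add: span_eq_iff)
  have B'_iff: "x \<in> B' \<longleftrightarrow> (\<exists>k. x - scale k c \<in> B)" for x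
    unfolding B'_def span_breakdown_eq spB ..
  have "spans_mod B' C"
    unfolding spans_mod_def
  proof
    fix x
    obtain y where y: "y \<in> span (insert c C)" "x - y \<in> B"
      using insert.prems(2) unfolding spans_mod_def by blast
    obtain k where k: "y - scale k c \<in> span C"
      using y(1) unfolding span_breakdown_eq by blast
    have "x - (y - scale k c) - scale k c \<in> B" using y(2) by simp
    then show "\<exists>z\<in>span C. x - z \<in> B'" using k B'_iff by blast
  qed
  then have cod: "codim_at_most (A \<inter> B') (m + card C)"
    by (rule insert.IH[rotated]) (simp add: B'_def)
  show ?case
  proof (cases "A \<inter> B' \<subseteq> B")
    case True
    then have "codim_at_most (A \<inter> B) (m + card C)"
      by (intro codim_at_most_mono[OF cod]) blast
    then show ?thesis
      using insert.hyps by (elim codim_at_most_le) simp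
  next
    case False
    then obtain a where a: "a \<in> A" "a \<in> B'" "a \<notin> B" by blast
    obtain k where k: "a - scale k c \<in> B" using a(2) B'_iff by blast
    have "k \<noteq> 0" using k a(3) by auto
    obtain D where D: "finite D" "card D \<le> m + card C" "spans_mod (A \<inter> B') D"
      using cod unfolding codim_at_most_def by blast
    have "spans_mod (A \<inter> B) (insert a D)"
      unfolding spans_mod_def
    proof
      fix x
      obtain y where y: "y \<in> span D" "x - y \<in> A" "x - y \<in> B'"
        using D(3) unfolding spans_mod_def by blast
      obtain l where l: "(x - y) - scale l c \<in> B" using y(3) B'_iff by blast
      \<comment> \<open>Modulo \<open>B\<close>, \<open>a\<close> is \<open>k\<close> times \<open>c\<close> and \<open>x - y\<close> is \<open>l\<close> times \<open>c\<close>, so this multiple of \<open>a\<close> cancels \<open>c\<close>.\<close>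
      define z where "z = y + scale (l / k) a"
      have "y \<in> span (insert a D)" using span_mono[OF subset_insertI] y(1) by (rule subsetD)
      then have "z \<in> span (insert a D)"
        unfolding z_def by (rule span_add) (simp add: span_scale span_base)
      moreover have inA: "x - z = (x - y) - scale (l / k) a"
        by (simp add: z_def)
      have "x - z \<in> A"
        unfolding inA
        by (rule subspace_diff[OF assms(2) y(2) subspace_scale[OF assms(2) a(1)]])
      moreover have inB: "x - z = ((x - y) - scale l c) - scale (l / k) (a - scale k c)"
        using \<open>k \<noteq> 0\<close> by (simp add: z_def scale_right_diff_distrib)
      have "x - z \<in> B"
        unfolding inB
        by (rule subspace_diff[OF insert.prems(1) l subspace_scale[OF insert.prems(1) k]])
      ultimately show "\<exists>z\<in>span (insert a D). x - z \<in> A \<inter> B" by blast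
    qed
    moreover have "card (insert a D) \<le> m + card (insert c C)"
      using D(1,2) insert.hyps by (simp add: card_insert_if)
    ultimately show ?thesis
      using D(1) unfolding codim_at_most_def by blast
  qed
qed

lemma codim_at_most_Int:
  assumes "subspace A" "codim_at_most A m" "subspace B" "codim_at_most B n"
  shows "codim_at_most (A \<inter> B) (m + n)"
proof -
  obtain C where C: "finite C" "card C \<le> n" "spans_mod B C"
    using assms(4) unfolding codim_at_most_def by blast
  show ?thesis
    by (rule codim_at_most_le[OF codim_at_most_Int_spans_mod[OF C(1) assms(1,2,3) C(3)]])
      (simp add: C(2))
qed

lemma codim_at_most_Inter:
  assumes "finite F" "\<forall>A\<in>F. subspace A \<and> codim_at_most A n"
  shows "codim_at_most (\<Inter>F) (card F * n)"
  using assms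
proof (induction F rule: finite_induct)
  case empty
  have "spans_mod UNIV {}" by (simp add: spans_mod_def)
  then show ?case unfolding codim_at_most_def by auto
next
  case (insert A F)
  then have "codim_at_most (A \<inter> \<Inter>F) (n + card F * n)"
    by (intro codim_at_most_Int subspace_Inter) auto
  then show ?case using insert.hyps by simp
qed

text \<open>
  Members of \<open>\<A>\<close> are added only when they enlarge the span of the union. Each addition lowers the
  bound for the codimension, so it happens at most \<open>n\<close> times.
\<close>

lemma span_Union_finite_subfamily:
  assumes "finite F" "F \<subseteq> \<A>" "codim_at_most (span (\<Union>F)) n"
  shows "\<exists>F'. finite F' \<and> F \<subseteq> F' \<and> F' \<subseteq> \<A> \<and> card F' \<le> card F + n \<and> span (\<Union>F') = span (\<Union>\<A>)"
  using assms
proof (induction n arbitrary: F rule: less_induct)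
  case (less n)
  show ?case
  proof (cases "\<Union>\<A> \<subseteq> span (\<Union>F)")
    case True
    have "span (\<Union>F) \<subseteq> span (\<Union>\<A>)"
      using less.prems(2) by (intro span_mono) blast
    moreover have "span (\<Union>\<A>) \<subseteq> span (\<Union>F)"
      using True by (intro span_minimal) auto
    ultimately show ?thesis using less.prems by (intro exI[of _ F]) auto
  next
    case False
    then obtain A where A: "A \<in> \<A>" "\<not> A \<subseteq> span (\<Union>F)" by blast
    have "A \<subseteq> span (\<Union>(insert A F))" by (auto intro: span_base)
    moreover have "span (\<Union>F) \<subseteq> span (\<Union>(insert A F))" by (intro span_mono) auto
    ultimately have "span (\<Union>F) \<subset> span (\<Union>(insert A F))" using A(2) by blast
    then have n: "0 < n" "codim_at_most (span (\<Union>(insert A F))) (n - 1)"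
      using codim_at_most_strict[OF _ _ _ less.prems(3)] by auto
    have "\<exists>F'. finite F' \<and> insert A F \<subseteq> F' \<and> F' \<subseteq> \<A> \<and> card F' \<le> card (insert A F) + (n - 1)
        \<and> span (\<Union>F') = span (\<Union>\<A>)"
      by (rule less.IH) (use n less.prems A(1) in auto)
    moreover have "card (insert A F) + (n - 1) \<le> card F + n"
      using n(1) less.prems(1) by (simp add: card_insert_if)
    ultimately show ?thesis by (elim ex_forward) auto
  qed
qed


section \<open>Multilinear elements\<close>

text \<open>
  A variable of degree one in a product occurs in exactly one factor, and the other factor does not
  depend on it; this is why evaluation is linear in each variable of a multilinear element.
\<close>

lemma eval_word_update_free:
  assumes "degree_in i m = 0"
  shows "eval_word (a(i := x)) m = eval_word a m"
  using assms by (induction m) (auto split: if_splits)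

lemma linear_eval_word_update:
  assumes "degree_in i m = 1"
  shows "Vector_Spaces.linear scale scale (\<lambda>x. eval_word (a(i := x)) m)"
  using assms
proof (induction m)
  case (Var j)
  then have "j = i" by (auto split: if_splits)
  then show ?case by (simp add: linear_ident)
next
  case (Prod u v)
  then consider "degree_in i u = 1" "degree_in i v = 0" | "degree_in i u = 0" "degree_in i v = 1"
    by (cases "degree_in i u") auto
  then show ?case
  proof cases
    case 1
    then show ?thesis
      using Vector_Spaces.linear_compose[OF Prod.IH(1)[OF 1(1)] linear_mult_left]
      by (simp add: eval_word_update_free o_def del: fun_upd_apply)
  next
    case 2
    then show ?thesis
      using Vector_Spaces.linear_compose[OF Prod.IH(2)[OF 2(2)] linear_mult_right]
      by (simp add: eval_word_update_free o_def del: fun_upd_apply)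
  qed
qed

lemma linear_eval_update:
  assumes "multilinear t w" "i \<in> {1..t}"
  shows "Vector_Spaces.linear scale scale (\<lambda>x. eval (a(i := x)) w)"
proof -
  interpret vector_space_pair scale scale ..
  show ?thesis
    unfolding eval_def
    using assms unfolding multilinear_def
    by (intro linear_compose_sum ballI linear_compose_scale_right linear_eval_word_update) auto
qed

lemma endomorphism_linear: "endomorphism \<phi> \<Longrightarrow> Vector_Spaces.linear scale scale \<phi>"
  by (simp add: endomorphism_def)

lemma eval_word_endomorphism:
  assumes "endomorphism \<phi>"
  shows "eval_word (\<phi> \<circ> a) m = \<phi> (eval_word a m)"
  using assms by (induction m) (auto simp: endomorphism_def)

lemma eval_endomorphism:
  assumes "endomorphism \<phi>"
  shows "eval (\<phi> \<circ> a) w = \<phi> (eval a w)"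
proof -
  interpret \<phi>: Vector_Spaces.linear scale scale \<phi>
    using assms by (simp add: endomorphism_def)
  show ?thesis
    unfolding eval_def by (simp add: eval_word_endomorphism[OF assms] \<phi>.sum \<phi>.scale)
qed

text \<open>
  The variables have to be moved from \<open>N\<close> to an invariant subspace one at a time, so the domains of
  the variables must be allowed to differ.
\<close>

definition vanishes_on :: "nat \<Rightarrow> (nat, 'k) free_algebra \<Rightarrow> (nat \<Rightarrow> 'g set) \<Rightarrow> bool" where
  "vanishes_on t w S \<longleftrightarrow> (\<forall>a. (\<forall>i\<in>{1..t}. a i \<in> S i) \<longrightarrow> eval a w = 0)"

lemma vanishes_on_mono:
  "vanishes_on t w S \<Longrightarrow> (\<And>i. S' i \<subseteq> S i) \<Longrightarrow> vanishes_on t w S'"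
  unfolding vanishes_on_def by (meson subsetD)

lemma vanishes_on_surj_image:
  assumes \<phi>: "endomorphism \<phi>" "surj \<phi>" and S: "vanishes_on t w S"
  shows "vanishes_on t w (\<lambda>i. \<phi> ` S i)"
  unfolding vanishes_on_def
proof (intro allI impI)
  fix a assume a: "\<forall>i\<in>{1..t}. a i \<in> \<phi> ` S i"
  \<comment> \<open>Surjectivity supplies preimages for the indices outside \<open>{1..t}\<close> as well, so that \<open>a = \<phi> \<circ> b\<close> everywhere.\<close>
  have "\<exists>b. a i = \<phi> b \<and> (i \<in> {1..t} \<longrightarrow> b \<in> S i)" for i
    using a \<phi>(2) by (cases "i \<in> {1..t}") auto
  then obtain b where b: "\<And>i. a i = \<phi> (b i) \<and> (i \<in> {1..t} \<longrightarrow> b i \<in> S i)" by metis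
  then have "a = \<phi> \<circ> b" by auto
  moreover have "eval b w = 0" using S b unfolding vanishes_on_def by blast
  moreover have "\<phi> 0 = 0"
    using endomorphism_linear[OF \<phi>(1)] by (simp add: linear_iff_module_hom module_hom.zero)
  ultimately show "eval a w = 0" by (simp add: eval_endomorphism[OF \<phi>(1)])
qed

lemma vanishes_on_span_Union:
  assumes w: "multilinear t w" and k: "k \<in> {1..t}"
    and van: "\<And>A. A \<in> F \<Longrightarrow> vanishes_on t w (S(k := A))"
  shows "vanishes_on t w (S(k := span (\<Union>F)))"
  unfolding vanishes_on_def
proof (intro allI impI)
  fix a assume a: "\<forall>i\<in>{1..t}. a i \<in> (S(k := span (\<Union>F))) i"
  interpret L: Vector_Spaces.linear scale scale "\<lambda>x. eval (a(k := x)) w"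
    by (rule linear_eval_update[OF w k])
  have "eval (a(k := x)) w = 0" if x: "x \<in> \<Union>F" for x
  proof -
    obtain A where A: "A \<in> F" "x \<in> A" using x by blast
    have "\<forall>i\<in>{1..t}. (a(k := x)) i \<in> (S(k := A)) i" using a A(2) by auto
    then show ?thesis using van[OF A(1)] unfolding vanishes_on_def by blast
  qed
  moreover have "a k \<in> span (\<Union>F)" using a k by (auto dest: bspec[of _ _ k])
  ultimately have "eval (a(k := a k)) w = 0" by (rule L.eq_0_on_span)
  then show "eval a w = 0" by simp
qed


section \<open>Images under surjective endomorphisms\<close>

definition surj_images :: "'g set \<Rightarrow> 'g set set" where
  "surj_images M = {\<phi> ` M |\<phi>. endomorphism \<phi> \<and> surj \<phi>}"

lemma self_in_surj_images: "M \<in> surj_images M"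
proof -
  have "endomorphism id" "surj id" by (simp_all add: endomorphism_def linear_id)
  then show ?thesis unfolding surj_images_def by (auto intro!: exI[of _ id])
qed

lemma image_in_surj_images:
  assumes \<phi>: "endomorphism \<phi>" "surj \<phi>" and A: "A \<in> surj_images M"
  shows "\<phi> ` A \<in> surj_images M"
proof -
  obtain \<psi> where \<psi>: "endomorphism \<psi>" "surj \<psi>" "A = \<psi> ` M"
    using A unfolding surj_images_def by blast
  have "endomorphism (\<phi> \<circ> \<psi>)"
    using \<phi>(1) \<psi>(1) Vector_Spaces.linear_compose[of scale scale \<psi> scale \<phi>] by (auto simp: endomorphism_def)
  moreover have "surj (\<phi> \<circ> \<psi>)" using \<phi>(2) \<psi>(2) by (rule comp_surj[rotated])
  ultimately show ?thesis unfolding surj_images_def \<psi>(3) image_comp by blast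
qed

lemma surj_images_properties:
  assumes "A \<in> surj_images M" "subspace M" "codim_at_most M n"
  shows "subspace A \<and> codim_at_most A n"
proof -
  obtain \<phi> where \<phi>: "endomorphism \<phi>" "surj \<phi>" "A = \<phi> ` M"
    using assms(1) unfolding surj_images_def by blast
  interpret \<phi>: Vector_Spaces.linear scale scale \<phi>
    by (rule endomorphism_linear[OF \<phi>(1)])
  show ?thesis
    using \<phi> assms(2,3) endomorphism_linear[OF \<phi>(1)]
    by (simp add: \<phi>.subspace_image codim_at_most_surj_image)
qed

text \<open>
  The images of \<open>M\<close> are mapped by \<open>\<phi>\<close> to images of \<open>M\<close>, so that the sum is mapped into itself.
  Its image cannot be smaller, since it has codimension at most that of the sum.
  Equality, and not just inclusion, is what the induction over the variables relies on.
\<close>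

lemma span_surj_images_invariant:
  assumes \<phi>: "endomorphism \<phi>" "surj \<phi>" and cod: "codim_at_most M n"
  shows "\<phi> ` span (\<Union>(surj_images M)) = span (\<Union>(surj_images M))"
proof (rule ccontr)
  let ?H = "span (\<Union>(surj_images M))"
  interpret \<phi>: Vector_Spaces.linear scale scale \<phi>
    by (rule endomorphism_linear[OF \<phi>(1)])
  have "\<phi> ` \<Union>(surj_images M) \<subseteq> \<Union>(surj_images M)"
    using image_in_surj_images[OF \<phi>] by blast
  then have sub: "\<phi> ` ?H \<subseteq> ?H"
    using span_mono by (simp flip: \<phi>.span_image)
  assume "\<phi> ` ?H \<noteq> ?H"
  then have proper: "\<phi> ` ?H \<subset> ?H" using sub by blast
  have "codim_at_most ?H n"
    using cod by (rule codim_at_most_mono) (use self_in_surj_images in \<open>auto intro: span_base\<close>)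
  then have least: "codim_at_most ?H (LEAST n. codim_at_most ?H n)" (is "codim_at_most _ ?m")
    by (rule LeastI)
  have "0 < ?m \<and> codim_at_most ?H (?m - 1)"
    by (rule codim_at_most_strict[OF _ _ proper])
      (auto intro: \<phi>.subspace_image codim_at_most_surj_image[OF \<phi>.linear_axioms \<phi>(2) least])
  then show False
    using Least_le[of "codim_at_most ?H" "?m - 1"] by linarith
qed


section \<open>Ideals\<close>

text \<open>
  Left and right ideals differ only in the order of the factors, so closure under multiplication is
  treated for an operation \<open>f\<close> that is either \<open>mult\<close> or \<open>mult\<close> with its arguments exchanged.
\<close>

definition absorbs :: "('g \<Rightarrow> 'g \<Rightarrow> 'g) \<Rightarrow> 'g set \<Rightarrow> bool" where
  "absorbs f M \<longleftrightarrow> (\<forall>g. \<forall>x\<in>M. f g x \<in> M)"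

lemma left_ideal_iff: "left_ideal I \<longleftrightarrow> subspace I \<and> absorbs mult I"
  and right_ideal_iff: "right_ideal I \<longleftrightarrow> subspace I \<and> absorbs (\<lambda>g x. mult x g) I"
  by (simp_all add: left_ideal_def right_ideal_def absorbs_def)

text \<open>
  Surjectivity lets every multiplier be written as \<open>\<phi> g'\<close>, so that the product is the image of a
  product with an element of \<open>M\<close>.
\<close>

lemma absorbs_surj_images:
  assumes f: "f = mult \<or> f = (\<lambda>g x. mult x g)" and M: "absorbs f M" and A: "A \<in> surj_images M"
  shows "absorbs f A"
proof -
  obtain \<phi> where \<phi>: "endomorphism \<phi>" "surj \<phi>" "A = \<phi> ` M"
    using A unfolding surj_images_def by blast
  have "\<phi> (mult x y) = mult (\<phi> x) (\<phi> y)" for x y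
    using \<phi>(1) by (simp add: endomorphism_def)
  then have hom: "\<phi> (f g x) = f (\<phi> g) (\<phi> x)" for g x
    using f by (elim disjE) simp_all
  have "f g (\<phi> x) \<in> \<phi> ` M" if "x \<in> M" for g x
  proof -
    obtain g' where "g = \<phi> g'" using \<phi>(2) by blast
    then have "f g (\<phi> x) = \<phi> (f g' x)" by (simp add: hom)
    then show ?thesis using M that unfolding absorbs_def by blast
  qed
  then show ?thesis unfolding absorbs_def \<phi>(3) by blast
qed

lemma absorbs_span_Union:
  assumes f: "f = mult \<or> f = (\<lambda>g x. mult x g)" and F: "\<And>A. A \<in> F \<Longrightarrow> absorbs f A"
  shows "absorbs f (span (\<Union>F))"
  unfolding absorbs_def
proof (intro allI ballI)
  fix g x assume x: "x \<in> span (\<Union>F)"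
  interpret L: Vector_Spaces.linear scale scale "f g"
    using f by (elim disjE) (simp_all only: linear_mult_left linear_mult_right)
  have "f g ` \<Union>F \<subseteq> \<Union>F" using F unfolding absorbs_def by blast
  then have "f g ` span (\<Union>F) \<subseteq> span (\<Union>F)"
    using span_mono by (simp flip: L.span_image)
  then show "f g x \<in> span (\<Union>F)" using x by blast
qed

lemma absorbs_Inter: "(\<And>A. A \<in> F \<Longrightarrow> absorbs f A) \<Longrightarrow> absorbs f (\<Inter>F)"
  unfolding absorbs_def by blast


section \<open>Symmetrizing one variable after the other\<close>

text \<open>
  The step described at the beginning. The first \<open>k\<close> variables range over an invariant subspace \<open>H\<close>, the
  others over \<open>M\<close>. Applying \<open>\<phi>\<close> leaves \<open>H\<close> unchanged and turns \<open>M\<close> into \<open>\<phi> M\<close>; so \<open>w\<close> vanishes if variable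
  \<open>k + 1\<close> lies in one of finitely many \<open>\<phi> M\<close> and the later ones lie in their intersection. Linearity in
  variable \<open>k + 1\<close> then permits the sum of these \<open>\<phi> M\<close>. Since this sum lies in \<open>H\<close>, the first \<open>k\<close>
  variables may be restricted to it, so that again a single invariant subspace serves for all of them.
\<close>

lemma symmetrize_next_variable:
  assumes w: "multilinear t w" and k: "k < t"
    and M: "subspace M" "codim_at_most M n"
    and H: "subspace H" "M \<subseteq> H" "\<And>\<phi>. endomorphism \<phi> \<Longrightarrow> surj \<phi> \<Longrightarrow> \<phi> ` H = H"
    and van: "vanishes_on t w (\<lambda>i. if i \<le> k then H else M)"
  obtains F where "finite F" "F \<subseteq> surj_images M" "M \<in> F" "codim_at_most (\<Inter>F) (n * (n + 1))"
    "vanishes_on t w (\<lambda>i. if i \<le> Suc k then span (\<Union>(surj_images M)) else \<Inter>F)"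
proof -
  \<comment> \<open>Starting from \<open>{M}\<close>, at most \<open>n\<close> further images are needed, whence the factor \<open>n + 1\<close>.\<close>
  have "codim_at_most (span (\<Union>{M})) n"
    using M(2) by (rule codim_at_most_mono) (simp add: span_superset)
  then obtain F where F: "finite F" "M \<in> F" "F \<subseteq> surj_images M" "card F \<le> 1 + n"
    "span (\<Union>F) = span (\<Union>(surj_images M))"
    using span_Union_finite_subfamily[of "{M}" "surj_images M" n] self_in_surj_images[of M] by auto
  have "codim_at_most (\<Inter>F) (card F * n)"
    using F surj_images_properties[OF _ M] by (intro codim_at_most_Inter) auto
  moreover have "card F * n \<le> n * (n + 1)"
    using mult_le_mono1[OF F(4), of n] by (simp add: algebra_simps)
  ultimately have cod: "codim_at_most (\<Inter>F) (n * (n + 1))" by (rule codim_at_most_le)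
  have "A \<subseteq> H" if A: "A \<in> surj_images M" for A
  proof -
    obtain \<phi> where \<phi>: "endomorphism \<phi>" "surj \<phi>" "A = \<phi> ` M"
      using A unfolding surj_images_def by blast
    then show ?thesis using H(2) H(3)[OF \<phi>(1,2)] by blast
  qed
  then have H': "span (\<Union>(surj_images M)) \<subseteq> H"
    using H(1) by (intro span_minimal) blast+
  let ?S = "\<lambda>i. if i \<le> k then H else \<Inter>F"
  have "vanishes_on t w (?S(Suc k := A))" if A: "A \<in> F" for A
  proof -
    obtain \<phi> where \<phi>: "endomorphism \<phi>" "surj \<phi>" "A = \<phi> ` M"
      using A F(3) unfolding surj_images_def by blast
    have "vanishes_on t w (\<lambda>i. \<phi> ` (if i \<le> k then H else M))"
      by (rule vanishes_on_surj_image[OF \<phi>(1,2) van])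
    moreover have "(?S(Suc k := A)) i \<subseteq> \<phi> ` (if i \<le> k then H else M)" for i
      using A H(3)[OF \<phi>(1,2)] \<phi>(3) by auto
    ultimately show ?thesis by (rule vanishes_on_mono)
  qed
  then have "vanishes_on t w (?S(Suc k := span (\<Union>F)))"
    using k by (intro vanishes_on_span_Union[OF w]) auto
  then have "vanishes_on t w (\<lambda>i. if i \<le> Suc k then span (\<Union>(surj_images M)) else \<Inter>F)"
  proof (rule vanishes_on_mono)
    fix i
    show "(if i \<le> Suc k then span (\<Union>(surj_images M)) else \<Inter>F) \<subseteq> (?S(Suc k := span (\<Union>F))) i"
      using H' F(5) by auto
  qed
  then show ?thesis using F(1,3,2) cod by (intro that)
qed

text \<open>
  The induction starts with \<open>H = G\<close>, which surjective endomorphisms map onto itself by definition.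
\<close>

lemma symmetrized_first_variables:
  assumes w: "multilinear t w" and N: "subspace N" "codim_at_most N n" "satisfies t w N"
    and k: "k < t"
  shows "\<exists>H M. subspace H \<and> subspace M \<and> M \<subseteq> H
    \<and> (\<forall>\<phi>. endomorphism \<phi> \<and> surj \<phi> \<longrightarrow> \<phi> ` H = H)
    \<and> codim_at_most M (((\<lambda>x. x * (x + 1)) ^^ k) n)
    \<and> vanishes_on t w (\<lambda>i. if i \<le> k then H else M)
    \<and> (\<forall>f. (f = mult \<or> f = (\<lambda>g x. mult x g)) \<and> absorbs f N \<longrightarrow> absorbs f M)"
  using k
proof (induction k)
  case 0
  have "vanishes_on t w (\<lambda>i. if i \<le> 0 then UNIV else N)"
    using N(3) unfolding satisfies_def vanishes_on_def by simp
  then show ?case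
    using N by (intro exI[of _ UNIV] exI[of _ N]) simp
next
  case (Suc k)
  then have "k < t" by simp
  from Suc.IH[OF this] obtain H M where
    HM: "subspace H" "subspace M" "M \<subseteq> H"
    and inv: "\<forall>\<phi>. endomorphism \<phi> \<and> surj \<phi> \<longrightarrow> \<phi> ` H = H"
    and cod: "codim_at_most M (((\<lambda>x. x * (x + 1)) ^^ k) n)" (is "codim_at_most M ?m")
    and van: "vanishes_on t w (\<lambda>i. if i \<le> k then H else M)"
    and abs: "\<forall>f. (f = mult \<or> f = (\<lambda>g x. mult x g)) \<and> absorbs f N \<longrightarrow> absorbs f M"
    by (elim exE conjE) (rule that)
  obtain F where F: "finite F" "F \<subseteq> surj_images M" "M \<in> F" "codim_at_most (\<Inter>F) (?m * (?m + 1))"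
    "vanishes_on t w (\<lambda>i. if i \<le> Suc k then span (\<Union>(surj_images M)) else \<Inter>F)"
    by (rule symmetrize_next_variable[OF w \<open>k < t\<close> HM(2) cod HM(1,3) inv[rule_format, OF conjI] van])
  have "subspace (\<Inter>F)"
    using F(2) surj_images_properties[OF _ HM(2) cod] by (intro subspace_Inter) blast
  moreover have "\<Inter>F \<subseteq> span (\<Union>(surj_images M))"
    using F(3) self_in_surj_images[of M] by (auto intro: span_base)
  moreover have "absorbs f (\<Inter>F)" if "f = mult \<or> f = (\<lambda>g x. mult x g)" "absorbs f N" for f
    using absorbs_surj_images[OF that(1) abs[rule_format, OF conjI[OF that]]] F(2) by (intro absorbs_Inter) blast
  ultimately show ?case
    using F(4,5) span_surj_images_invariant[OF _ _ cod]
    by (intro exI[of _ "span (\<Union>(surj_images M))"] exI[of _ "\<Inter>F"]) auto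
qed

text \<open>
  After \<open>t - 1\<close> steps only the last variable still ranges over \<open>M\<close>. One more step moves it to the sum \<open>H\<close>
  of the images of \<open>M\<close>. As \<open>H\<close> contains \<open>M\<close>, its codimension obeys the bound for \<open>M\<close>: the \<open>t\<close>-th step does
  not apply \<open>x (x + 1)\<close> again, so the iteration count is \<open>t - 1\<close> and not \<open>t\<close>.
\<close>

lemma invariant_subspace_satisfying_identity:
  assumes t: "t \<ge> 1" and w: "multilinear t w"
    and N: "subspace N" "finite_codim N" "satisfies t w N"
  shows "\<exists>H. subspace H \<and> satisfies t w H
    \<and> (\<forall>\<phi>. endomorphism \<phi> \<and> surj \<phi> \<longrightarrow> \<phi> ` H \<subseteq> H)
    \<and> finite_codim H \<and> codim H \<le> ((\<lambda>x. x * (x + 1)) ^^ (t - 1)) (codim N)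
    \<and> (left_ideal N \<longrightarrow> left_ideal H) \<and> (right_ideal N \<longrightarrow> right_ideal H)
    \<and> (two_sided_ideal N \<longrightarrow> two_sided_ideal H)"
proof -
  have codN: "codim_at_most N (codim N)" using N by (simp add: codim_at_most_iff)
  have "t - 1 < t" using t by simp
  from symmetrized_first_variables[OF w N(1) codN N(3) this] obtain G M where
    GM: "subspace G" "subspace M" "M \<subseteq> G"
    and inv: "\<forall>\<phi>. endomorphism \<phi> \<and> surj \<phi> \<longrightarrow> \<phi> ` G = G"
    and cod: "codim_at_most M (((\<lambda>x. x * (x + 1)) ^^ (t - 1)) (codim N))"
      (is "codim_at_most M ?m")
    and van: "vanishes_on t w (\<lambda>i. if i \<le> t - 1 then G else M)"
    and abs: "\<forall>f. (f = mult \<or> f = (\<lambda>g x. mult x g)) \<and> absorbs f N \<longrightarrow> absorbs f M"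
    by (elim exE conjE) (rule that)
  define H where "H = span (\<Union>(surj_images M))"
  obtain F where "vanishes_on t w (\<lambda>i. if i \<le> Suc (t - 1) then H else \<Inter>F)"
    unfolding H_def
    by (rule symmetrize_next_variable[OF w \<open>t - 1 < t\<close> GM(2) cod GM(1,3) inv[rule_format, OF conjI] van])
  then have "satisfies t w H"
    using t unfolding satisfies_def vanishes_on_def by simp
  moreover have H: "subspace H" by (simp add: H_def)
  moreover have "codim_at_most H ?m"
    using cod by (rule codim_at_most_mono)
      (use self_in_surj_images in \<open>auto simp: H_def intro: span_base\<close>)
  then have "finite_codim H" "codim H \<le> ?m" using H by (simp_all add: codim_at_most_iff)
  moreover have "absorbs f H" if "f = mult \<or> f = (\<lambda>g x. mult x g)" "absorbs f N" for f
    unfolding H_def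
    using absorbs_surj_images[OF that(1) abs[rule_format, OF conjI[OF that]]] by (rule absorbs_span_Union[OF that(1)])
  ultimately show ?thesis
    using span_surj_images_invariant[OF _ _ cod]
    by (intro exI[of _ H])
      (auto simp: left_ideal_iff right_ideal_iff two_sided_ideal_def simp flip: H_def)
qed

end

theorem theorem2:
  fixes scale :: "'k::field \<Rightarrow> 'g::ab_group_add \<Rightarrow> 'g"
    and mult :: "'g \<Rightarrow> 'g \<Rightarrow> 'g"
    and N :: "'g set"
    and t :: nat
    and w :: "(nat, 'k) free_algebra"
  assumes "nonassoc_algebra scale mult"
    and "t \<ge> 1"
    and "multilinear t w"
    and "module.subspace scale N"
    and "nonassoc_algebra.finite_codim scale N"
    and "nonassoc_algebra.satisfies scale mult t w N"
  shows "\<exists>H. module.subspace scale H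
    \<and> nonassoc_algebra.satisfies scale mult t w H
    \<and> (\<forall>\<phi>. nonassoc_algebra.endomorphism scale mult \<phi> \<and> surj \<phi> \<longrightarrow> \<phi> ` H \<subseteq> H)
    \<and> nonassoc_algebra.finite_codim scale H
    \<and> nonassoc_algebra.codim scale H \<le> ((\<lambda>x. x * (x + 1)) ^^ (t - 1)) (nonassoc_algebra.codim scale N)
    \<and> (nonassoc_algebra.left_ideal scale mult N \<longrightarrow> nonassoc_algebra.left_ideal scale mult H)
    \<and> (nonassoc_algebra.right_ideal scale mult N \<longrightarrow> nonassoc_algebra.right_ideal scale mult H)
    \<and> (nonassoc_algebra.two_sided_ideal scale mult N \<longrightarrow>
         nonassoc_algebra.two_sided_ideal scale mult H)"
  using nonassoc_algebra.invariant_subspace_satisfying_identity[OF assms] .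

end
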